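(* There are infinitely many pairwise nonequivalent sets $\{a,b,c,d\}$ of four distinct nonzero integers with the property that there exist two distinct nonzero integers $n_1\neq n_2$ such that $\{a,b,c,d\}$ is a $D(n_1)$-quadruple and also a $D(n_2)$-quadruple.
   Context: For an integer $n$, a set $\{a_1,\dots,a_m\}$ of $m$ distinct nonzero integers is called a $D(n)$-$m$-tuple (for $m=4$, a $D(n)$-quadruple) if $a_ia_j+n$ is a perfect square (square of an integer) for all $1\le i<j\le m$. Two sets are called equivalent if one is obtained from the other by multiplying all elements by a common nonzero rational number $u$: if $\{a,b,c,d\}$ is a $D(n_1)$- and $D(n_2)$-quadruple and $au,bu,cu,du,n_1u^2,n_2u^2$ are integers, then $\{au,bu,cu,du\}$ is a $D(n_1u^2)$- and $D(n_2u^2)$-quadruple, and these two quadruples are considered equivalent. *)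

theory Defs
  imports Main "HOL.Rat" "HOL-Computational_Algebra.Nth_Powers"
begin

definition D_tuple :: "int \<Rightarrow> nat \<Rightarrow> int set \<Rightarrow> bool" where
  "D_tuple n m A \<longleftrightarrow>
     finite A \<and> card A = m \<and> 0 \<notin> A \<and>
     (\<forall>a\<in>A. \<forall>b\<in>A. a \<noteq> b \<longrightarrow> is_square (a * b + n))"

(* The parameters n do not enter here: equivalence is a relation between the sets alone,
   and the factor u may be negative. *)
definition scaling_equivalent :: "int set \<Rightarrow> int set \<Rightarrow> bool" where
  "scaling_equivalent A B \<longleftrightarrow>
     (\<exists>u::rat. u \<noteq> 0 \<and> of_int ` B = (\<lambda>a. u * of_int a) ` A)"

end

theory Submission imports Defs begin

text \<open>
  Let \<open>L\<close> be the set of rationals \<open>x\<close> for which \<open>x\<^sup>2 + 1\<close> is a square. If a number \<open>N\<close> has three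
  representations \<open>N = p p' = q q' = r r'\<close> as a product of elements of \<open>L\<close>, then
  \<open>a = p q r / N\<close>, \<open>b = p q' r' / N\<close>, \<open>c = p' q r' / N\<close>, \<open>d = p' q' r / N\<close> have the pairwise products
  \<open>p\<^sup>2, p'\<^sup>2, q\<^sup>2, q'\<^sup>2, r\<^sup>2, r'\<^sup>2\<close>. So they form a rational \<open>D(1)\<close>-quadruple, and also a
  \<open>D(N\<^sup>2)\<close>-quadruple because \<open>p\<^sup>2 + N\<^sup>2 = p\<^sup>2 (1 + p'\<^sup>2)\<close>. New representations come from old ones by
  doubling points on \<open>Y\<^sup>2 = X (X + 1) (X + N\<^sup>2)\<close>, where \<open>X = p\<^sup>2\<close>. We start from \<open>p' = 3/4\<close> and
  large \<open>p\<close> and double twice; the resulting ratio \<open>a / d\<close> is unbounded, which gives infinitely many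
  classes after clearing denominators.
\<close>

section \<open>Rational quadruples\<close>

definition rat_square :: "rat \<Rightarrow> bool" where
  "rat_square x \<longleftrightarrow> (\<exists>y. x = y\<^sup>2)"

lemma rat_square_mult: "rat_square x \<Longrightarrow> rat_square y \<Longrightarrow> rat_square (x * y)"
  unfolding rat_square_def by (metis power_mult_distrib)

lemma rat_square_power2: "rat_square (x\<^sup>2)"
  unfolding rat_square_def by blast

text \<open>
  \<open>q\<^sup>2\<close> is the \<open>X\<close>-coordinate of the double of the point with \<open>X = x\<^sup>2\<close>. The bounds force repeated
  doubling to produce interlaced, hence distinct, representations.
\<close>

lemma leg_product_doubling:
  fixes x y w u :: rat
  assumes "0 < y" "2 * y \<le> x" "1 \<le> x" "0 < w" "0 < u" and w: "w\<^sup>2 = x\<^sup>2 + 1" and u: "u\<^sup>2 = y\<^sup>2 + 1"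
  obtains q q' v v' where "q * q' = x * y" "0 < v" "v\<^sup>2 = q\<^sup>2 + 1" "0 < v'" "v'\<^sup>2 = q'\<^sup>2 + 1"
    "0 < q" "q < x" "x \<le> 4 * u * q" "y < q'" "q' \<le> 4 * u * y"
proof -
  \<comment> \<open>With X = \<open>x^2\<close>, N = \<open>x * y\<close>, Y =
    \<open>x^2 * w * u\<close>, the duplication formula on Y^2 = X (X + 1) (X + N^2) gives ((X^2 -
    N^2) / (2 Y))^2, whose square root simplifies to \<open>q\<close>. The values \<open>v\<close>
    and \<open>v'\<close> are the square roots that certify \<open>q\<close> and
    \<open>q'\<close>.\<close>
  define q where "q = (x\<^sup>2 - y\<^sup>2) / (2 * w * u)"
  define q' where "q' = x * y / q"
  define v where "v = (w\<^sup>2 + u\<^sup>2) / (2 * w * u)"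
  define v' where "v' = (2 * x\<^sup>2 * y\<^sup>2 + x\<^sup>2 + y\<^sup>2) / (x\<^sup>2 - y\<^sup>2)"
  have x: "0 < x" using assms by linarith
  have sq: "(2 * y)\<^sup>2 \<le> x\<^sup>2" using assms by (intro power_mono) auto
  have y2: "0 < y\<^sup>2" using assms by simp
  have xy: "3 / 4 * x\<^sup>2 \<le> x\<^sup>2 - y\<^sup>2" using sq by (simp add: power_mult_distrib)
  have pos: "0 < x\<^sup>2 - y\<^sup>2" by (rule less_le_trans[OF _ xy]) (use x in simp)
  have q: "0 < q" using pos assms by (simp add: q_def)
  have qw: "q * (2 * w * u) = x\<^sup>2 - y\<^sup>2" using assms by (simp add: q_def)
  have "1 < u" using u y2 \<open>0 < u\<close> by (intro power_less_imp_less_base[of 1 2 u]) auto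
  have "x < w" using w \<open>0 < w\<close> by (intro power_less_imp_less_base[of x 2 w]) auto
  \<comment> \<open>Together with \<open>xy\<close> this yields the lower bound on \<open>q\<close>:
    the numerator is at least \<open>3 / 4 * x^2\<close> and the denominator at most
    \<open>3 * x * u\<close>.\<close>
  have "w\<^sup>2 \<le> (3 / 2 * x)\<^sup>2"
  proof -
    have "1 \<le> x\<^sup>2" using assms by simp
    then show ?thesis using w by (simp add: power_mult_distrib power_divide)
  qed
  then have wx: "w \<le> 3 / 2 * x" using x by (intro power2_le_imp_le[of w]) auto
  show thesis
  proof (rule that[of q q' v v'])
    show qq': "q * q' = x * y" using q by (simp add: q'_def)
    show "0 < q" by (rule q)
    show "0 < v" using assms by (simp add: v_def add_pos_pos)
    show "v\<^sup>2 = q\<^sup>2 + 1"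
    proof -
      have "x\<^sup>2 - y\<^sup>2 = w\<^sup>2 - u\<^sup>2" using w u by simp
      moreover have "(w\<^sup>2 + u\<^sup>2)\<^sup>2 = (w\<^sup>2 - u\<^sup>2)\<^sup>2 + (2 * w * u)\<^sup>2" by algebra
      moreover have "q\<^sup>2 + 1 = ((x\<^sup>2 - y\<^sup>2)\<^sup>2 + (2 * w * u)\<^sup>2) / (2 * w * u)\<^sup>2"
        using assms(4,5) by (simp add: q_def power_divide add_divide_distrib)
      ultimately show ?thesis by (simp only: v_def power_divide)
    qed
    show "0 < v'" using pos x y2 by (simp add: v'_def add_nonneg_pos)
    show "v'\<^sup>2 = q'\<^sup>2 + 1"
    proof -
      have "q'\<^sup>2 * (x\<^sup>2 - y\<^sup>2)\<^sup>2 = (x * y * (2 * w * u))\<^sup>2"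
        using q by (simp add: q'_def mult_ac flip: qw power_mult_distrib)
      also have "\<dots> = 4 * x\<^sup>2 * y\<^sup>2 * (x\<^sup>2 + 1) * (y\<^sup>2 + 1)"
        by (simp add: power_mult_distrib w u)
      finally have "(q'\<^sup>2 + 1) * (x\<^sup>2 - y\<^sup>2)\<^sup>2 = (2 * x\<^sup>2 * y\<^sup>2 + x\<^sup>2 + y\<^sup>2)\<^sup>2"
        by algebra
      then show ?thesis using pos by (simp add: v'_def power_divide field_simps)
    qed
    show qx: "q < x"
    proof -
      have "x * 1 \<le> w * u" using \<open>x < w\<close> \<open>1 < u\<close> assms(4) by (intro mult_mono) auto
      then have "x * x \<le> x * (w * u)" using x by (intro mult_left_mono) auto
      moreover have "0 \<le> x * (w * u)" using x assms(4,5) by simp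
      ultimately have "x\<^sup>2 - y\<^sup>2 < 2 * (x * (w * u))"
        using y2 by (simp add: power2_eq_square)
      then have "q * (2 * w * u) < x * (2 * w * u)" unfolding qw by (simp add: mult_ac)
      then show ?thesis using assms(4,5) by simp
    qed
    show xq: "x \<le> 4 * u * q"
    proof -
      have "3 / 4 * x\<^sup>2 \<le> q * (2 * w * u)" using xy qw by simp
      also have "\<dots> \<le> q * (2 * (3 / 2 * x) * u)"
        using wx q assms(5) by (intro mult_left_mono mult_right_mono) auto
      finally have "x * (3 / 4 * x) \<le> x * (3 * (q * u))" by (simp add: power2_eq_square mult_ac)
      then have "3 / 4 * x \<le> 3 * (q * u)" using x by (simp only: mult_le_cancel_left_pos)
      then show ?thesis by (simp add: mult_ac)
    qed
    \<comment> \<open>Since \<open>q * q' = x * y\<close>, the two bounds on \<open>q\<close> turn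
      into bounds on the complementary factor \<open>q'\<close>.\<close>
    have "q * y < q * q'" using qx assms(1) by (simp add: qq')
    then show "y < q'" using q by simp
    have "q * q' \<le> q * (4 * u * y)"
      using mult_right_mono[OF xq, of y] assms(1) unfolding qq' by (simp add: mult_ac)
    then show "q' \<le> 4 * u * y" using q by simp
  qed
qed

text \<open>The interlacing makes the four elements distinct: neighbours in a > b > c > d share the
  factor \<open>p\<close>, \<open>r'\<close> or \<open>p'\<close>, and the remaining factors are
  compared. The ratio in the conclusion is a / d, later made large by fixing \<open>p'\<close> and
  letting \<open>q\<close> grow.\<close>

lemma quadruple_of_three_leg_products:
  fixes p p' q q' r r' N :: rat
  assumes "0 < p'" "p' < q'" "q' < r'" "r' < r" "r < q" "q < p"
    and N: "p * p' = N" "q * q' = N" "r * r' = N"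
    and sq: "\<And>x. x \<in> {p, p', q, q', r, r'} \<Longrightarrow> rat_square (x\<^sup>2 + 1)"
  obtains X where "finite X" "card X = 4" "0 \<notin> X"
    "\<And>x y. x \<in> X \<Longrightarrow> y \<in> X \<Longrightarrow> x \<noteq> y \<Longrightarrow> rat_square (x * y + 1) \<and> rat_square (x * y + N\<^sup>2)"
    "\<exists>x\<in>X. \<exists>y\<in>X. x / y = (q / p')\<^sup>2"
proof -
  define a b c d where "a = p * q * r / N" and "b = p * q' * r' / N"
    and "c = p' * q * r' / N" and "d = p' * q' * r / N"
  note abcd = a_def b_def c_def d_def
  have pos: "0 < p" "0 < p'" "0 < q" "0 < q'" "0 < r" "0 < r'" using assms(1-6) by linarith+
  have "0 < N" using pos N by auto
  have prods: "a * b = p\<^sup>2" "c * d = p'\<^sup>2" "a * c = q\<^sup>2" "b * d = q'\<^sup>2" "a * d = r\<^sup>2" "b * c = r'\<^sup>2"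
  proof -
    have "a * b = p\<^sup>2 * ((q * q') * (r * r')) / (N * N)" "c * d = p'\<^sup>2 * ((q * q') * (r * r')) / (N * N)"
      "a * c = q\<^sup>2 * ((p * p') * (r * r')) / (N * N)" "b * d = q'\<^sup>2 * ((p * p') * (r * r')) / (N * N)"
      "a * d = r\<^sup>2 * ((p * p') * (q * q')) / (N * N)" "b * c = r'\<^sup>2 * ((p * p') * (q * q')) / (N * N)"
      by (simp_all add: abcd power2_eq_square mult_ac)
    then show "a * b = p\<^sup>2" "c * d = p'\<^sup>2" "a * c = q\<^sup>2" "b * d = q'\<^sup>2" "a * d = r\<^sup>2" "b * c = r'\<^sup>2"
      using \<open>0 < N\<close> unfolding N by simp_all
  qed
  have "q' * r' < q * r" using pos assms(1-6) by (intro mult_strict_mono) auto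
  then have "b < a" using pos \<open>0 < N\<close> by (simp add: abcd divide_strict_right_mono mult.assoc)
  have "p' * q < p * q'"
    using mult_strict_mono[of p' q' q p] pos assms(1-6) by (simp add: mult.commute)
  then have "c < b" using pos \<open>0 < N\<close> by (simp add: abcd divide_strict_right_mono)
  have "q' * r < q * r'"
    using mult_strict_mono[of q' r' r q] pos assms(1-6) by (simp add: mult.commute)
  then have "d < c" using pos \<open>0 < N\<close> by (simp add: abcd divide_strict_right_mono mult.assoc)
  have "0 < d" using pos \<open>0 < N\<close> by (simp add: abcd)
  have one: "rat_square (x\<^sup>2 + 1)" and two: "rat_square (x\<^sup>2 + N\<^sup>2)"
    if "x \<in> {p, p', q, q', r, r'}" for x
  proof -
    show "rat_square (x\<^sup>2 + 1)" using that by (rule sq)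
    have "\<exists>y\<in>{p, p', q, q', r, r'}. x * y = N"
      using that N by (elim insertE emptyE; simp add: mult.commute)
    then obtain y where y: "y \<in> {p, p', q, q', r, r'}" and "x * y = N" by blast
    have "rat_square (x\<^sup>2 * (y\<^sup>2 + 1))" by (rule rat_square_mult[OF rat_square_power2 sq[OF y]])
    also have "x\<^sup>2 * (y\<^sup>2 + 1) = x\<^sup>2 + N\<^sup>2" unfolding \<open>x * y = N\<close>[symmetric] by algebra
    finally show "rat_square (x\<^sup>2 + N\<^sup>2)" .
  qed
  let ?X = "{a, b, c, d}"
  show thesis
  proof (rule that[of ?X])
    show "finite ?X" by simp
    show "card ?X = 4" using \<open>b < a\<close> \<open>c < b\<close> \<open>d < c\<close> by simp
    show "0 \<notin> ?X" using \<open>b < a\<close> \<open>c < b\<close> \<open>d < c\<close> \<open>0 < d\<close> by auto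
    show "rat_square (x * y + 1) \<and> rat_square (x * y + N\<^sup>2)"
      if "x \<in> ?X" "y \<in> ?X" "x \<noteq> y" for x y
    proof -
      have "x * y \<in> {a * b, c * d, a * c, b * d, a * d, b * c}"
        using that by (elim insertE emptyE; simp add: mult.commute)
      then have "x * y \<in> power2 ` {p, p', q, q', r, r'}" unfolding prods image_insert image_empty .
      then obtain z where z: "z \<in> {p, p', q, q', r, r'}" and "x * y = z\<^sup>2" by (rule imageE)
      then show ?thesis using one[OF z] two[OF z] by (simp only:)
    qed
    \<comment> \<open>Cross-multiplied, this is \<open>p * p' = q * q'\<close>.\<close>
    have "p / q' = q / p'" using N pos by (simp add: frac_eq_eq)
    moreover have "a / d = (p / q') * (q / p')"
      using pos \<open>0 < N\<close> by (simp add: abcd mult.commute)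
    ultimately have "a / d = (q / p')\<^sup>2" by (simp add: power2_eq_square)
    then show "\<exists>x\<in>?X. \<exists>y\<in>?X. x / y = (q / p')\<^sup>2" by blast
  qed
qed

lemma rational_quadruple_large_ratio:
  fixes t :: rat
  assumes t: "10000 \<le> t"
  obtains X N where "finite X" "card X = 4" "0 \<notin> X" "1 < N"
    "\<And>x y. x \<in> X \<Longrightarrow> y \<in> X \<Longrightarrow> x \<noteq> y \<Longrightarrow> rat_square (x * y + 1) \<and> rat_square (x * y + N\<^sup>2)"
    "\<exists>x\<in>X. \<exists>y\<in>X. t / 20 \<le> x / y"
proof -
  \<comment> \<open>The rational parametrisation of \<open>w^2 - p^2 = 1\<close>, namely
    \<open>w + p = t\<close> and \<open>w - p = 1 / t\<close>.\<close>
  define p w where "p = (t\<^sup>2 - 1) / (2 * t)" and "w = (t\<^sup>2 + 1) / (2 * t)"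
  have w: "0 < w" "w\<^sup>2 = p\<^sup>2 + 1"
    using t by (simp_all add: w_def p_def add_nonneg_pos field_simps power2_eq_square)
  have "t / 2 - 1 \<le> p" using t by (simp add: p_def field_simps power2_eq_square)
  then have p: "t / 4 \<le> p" "4900 \<le> p" using t by linarith+
  have sq34: "(5 / 4)\<^sup>2 = (3 / 4)\<^sup>2 + (1 :: rat)" by (simp add: power2_eq_square)
  obtain q q' v v' where q: "q * q' = p * (3 / 4)" "0 < v" "v\<^sup>2 = q\<^sup>2 + 1" "0 < v'" "v'\<^sup>2 = q'\<^sup>2 + 1"
    "0 < q" "q < p" "p \<le> 4 * (5 / 4) * q" "3 / 4 < q'" "q' \<le> 4 * (5 / 4) * (3 / 4)"
    by (rule leg_product_doubling[OF _ _ _ w(1) _ w(2) sq34]) (use p in auto)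
  have "q'\<^sup>2 \<le> (15 / 4)\<^sup>2" using q by (intro power_mono) auto
  then have "v'\<^sup>2 \<le> 4\<^sup>2" using q by (simp add: power2_eq_square)
  then have v': "v' \<le> 4" by (rule power2_le_imp_le) simp
  obtain r r' z z' where r: "r * r' = q * q'" "0 < z" "z\<^sup>2 = r\<^sup>2 + 1" "0 < z'" "z'\<^sup>2 = r'\<^sup>2 + 1"
    "0 < r" "r < q" "q \<le> 4 * v' * r" "q' < r'" "r' \<le> 4 * v' * q'"
    by (rule leg_product_doubling[OF _ _ _ q(2,4,3,5)]) (use p q in auto)
  \<comment> \<open>The first doubling gives \<open>p \<le> 5 * q\<close> and
    \<open>q' \<le> 15 / 4\<close>, the second \<open>q \<le> 16 * r\<close> and
    \<open>r' \<le> 60\<close>. As \<open>p\<close> is at least 4900, \<open>r\<close> is at least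
    4900 / 80 > 60, so the chain stays interlaced.\<close>
  have "v' * r \<le> 4 * r" "v' * q' \<le> 4 * q'" using v' r q by auto
  then have "q \<le> 16 * r" "r' \<le> 60" using r q by linarith+
  then have "r' < r" using p q by linarith
  have legs: "rat_square (x\<^sup>2 + 1)" if "x \<in> {p, 3 / 4, q, q', r, r'}" for x
    using that by (elim insertE emptyE) (simp_all only: rat_square_power2[of w, unfolded w(2)] rat_square_power2[of "5 / 4", unfolded sq34]
      rat_square_power2[of v, unfolded q(3)] rat_square_power2[of v', unfolded q(5)]
      rat_square_power2[of z, unfolded r(3)] rat_square_power2[of z', unfolded r(5)])
  obtain X where X: "finite X" "card X = 4" "0 \<notin> X"
    "\<And>x y. x \<in> X \<Longrightarrow> y \<in> X \<Longrightarrow> x \<noteq> y \<Longrightarrow>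
      rat_square (x * y + 1) \<and> rat_square (x * y + (p * (3 / 4))\<^sup>2)"
    "\<exists>x\<in>X. \<exists>y\<in>X. x / y = (q / (3 / 4))\<^sup>2"
    by (rule quadruple_of_three_leg_products[of "3 / 4" q' r' r q p "p * (3 / 4)"])
      (use q r \<open>r' < r\<close> legs in auto)
  have "t / 20 \<le> q / (3 / 4)" "1 \<le> q / (3 / 4)" using p q by simp_all
  then have "t / 20 \<le> (q / (3 / 4))\<^sup>2"
    using self_le_power[of "q / (3 / 4)" 2] by linarith
  moreover have "1 < p * (3 / 4)" using p by simp
  ultimately show thesis using that X by metis
qed

section \<open>Clearing denominators\<close>

lemma rat_sqrt_of_int_in_Ints:
  fixes x :: rat
  assumes "x\<^sup>2 = of_int n"
  shows "x \<in> \<int>"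
proof -
  obtain a b where ab: "quotient_of x = (a, b)" by fastforce
  have x: "x = of_int a / of_int b" and b: "0 < b" and co: "coprime a b"
    using quotient_of_div[OF ab] quotient_of_denom_pos[OF ab] quotient_of_coprime[OF ab] by auto
  have "of_int (a\<^sup>2) = (of_int (n * b\<^sup>2) :: rat)"
    using assms b by (simp add: x field_simps)
  then have "b\<^sup>2 dvd a\<^sup>2" by (simp only: of_int_eq_iff) simp
  then have "b dvd a" by simp
  then have "is_unit b" using co by (metis coprime_common_divisor dvd_refl)
  then have "b = 1" using b by simp
  then show ?thesis by (simp add: x)
qed

lemma is_square_of_int_eq:
  assumes "of_int n = (x :: rat)\<^sup>2"
  shows "is_square n"
proof -
  obtain m where "x = of_int m" using rat_sqrt_of_int_in_Ints[of x n] assms by (metis Ints_cases)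
  then have "n = m\<^sup>2" using assms by (metis of_int_eq_iff of_int_power)
  then show ?thesis by (auto simp: is_nth_power_def)
qed

lemma common_denominator:
  fixes X :: "rat set"
  assumes "finite X"
  shows "\<exists>D :: int. 0 < D \<and> (\<forall>x\<in>X. of_int D * x \<in> \<int>)"
  using assms
proof induction
  case empty
  show ?case by (intro exI[of _ 1]) simp
next
  case (insert x X)
  then obtain D :: int where D: "0 < D" "\<forall>x\<in>X. of_int D * x \<in> \<int>" by auto
  obtain a b where ab: "quotient_of x = (a, b)" by fastforce
  have x: "x = of_int a / of_int b" and b: "0 < b"
    using quotient_of_div[OF ab] quotient_of_denom_pos[OF ab] by auto
  have "of_int (D * b) * x = of_int (D * a)" using b by (simp add: x)
  then have "of_int (D * b) * x \<in> \<int>" by (metis Ints_of_int)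
  moreover have "of_int (D * b) * y \<in> \<int>" if "y \<in> X" for y
  proof -
    have "of_int (D * b) * y = of_int b * (of_int D * y)" by simp
    then show ?thesis using D that by (metis Ints_mult Ints_of_int)
  qed
  ultimately show ?case using D b by (intro exI[of _ "D * b"]) simp
qed

text \<open>Scaling by \<open>D\<close> multiplies \<open>x * y + k\<close> by \<open>D^2\<close>,
  which keeps it a rational square; being an integer, it is then the square of an integer.\<close>

lemma D_tuple_scaled:
  assumes "finite X" "card X = m" "0 \<notin> X" "0 < (D :: int)" and A: "of_int ` A = (*) (of_int D) ` X"
    and n: "of_int n = (of_int D)\<^sup>2 * (k :: rat)"
    and sq: "\<And>x y. x \<in> X \<Longrightarrow> y \<in> X \<Longrightarrow> x \<noteq> y \<Longrightarrow> rat_square (x * y + k)"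
  shows "D_tuple n m A"
proof -
  have inj: "inj_on (of_int :: int \<Rightarrow> rat) A" by (simp add: inj_on_def)
  have "finite A" using A assms(1) finite_imageD[OF _ inj] by simp
  moreover have "card A = m"
    using card_image[OF inj] card_image[of "(*) (of_int D :: rat)" X] assms(2,4) A
    by (simp add: inj_on_def)
  moreover have "0 \<notin> A"
  proof
    assume "0 \<in> A"
    then have "of_int 0 \<in> (*) (of_int D :: rat) ` X" unfolding A[symmetric] by (rule imageI)
    then show False using assms(3,4) by auto
  qed
  moreover have "is_square (a * b + n)" if ab: "a \<in> A" "b \<in> A" "a \<noteq> b" for a b
  proof -
    have "of_int a \<in> (*) (of_int D) ` X" "of_int b \<in> (*) (of_int D) ` X"
      using ab unfolding A[symmetric] by auto
    then obtain x y where xy: "x \<in> X" "y \<in> X" "of_int a = of_int D * x" "of_int b = of_int D * y"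
      by auto
    then have "x \<noteq> y" using ab(3) by auto
    then obtain z where "x * y + k = z\<^sup>2" using sq xy unfolding rat_square_def by blast
    then have "of_int (a * b + n) = (of_int D * z)\<^sup>2"
      by (simp add: xy n power_mult_distrib power2_eq_square flip: distrib_left) algebra
    then show ?thesis by (rule is_square_of_int_eq)
  qed
  ultimately show ?thesis unfolding D_tuple_def by blast
qed

section \<open>Infinitely many classes\<close>

text \<open>The invariant that separates classes: a common factor cancels in every quotient.\<close>

definition ratios :: "int set \<Rightarrow> rat set" where
  "ratios A = {of_int x / of_int y | x y. x \<in> A \<and> y \<in> A}"

lemma ratios_of_int_image:
  "ratios A = {x / y | x y. x \<in> of_int ` A \<and> y \<in> of_int ` A}"
  unfolding ratios_def by blast

lemma ratios_scaled:
  assumes "(u :: rat) \<noteq> 0" "of_int ` B = (*) u ` X"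
  shows "ratios B = {x / y | x y. x \<in> X \<and> y \<in> X}"
proof -
  have "ratios B = {(u * x) / (u * y) | x y. x \<in> X \<and> y \<in> X}"
    unfolding ratios_of_int_image assms(2) by blast
  \<comment> \<open>Cancelling \<open>u\<close> is valid for \<open>y = 0\<close> too, where both
    quotients are 0 by convention.\<close>
  then show ?thesis using assms(1) by simp
qed

lemma ratios_scaling_equivalent:
  assumes "scaling_equivalent A B"
  shows "ratios A = ratios B"
proof -
  obtain u :: rat where u: "u \<noteq> 0" "of_int ` B = (\<lambda>a. u * of_int a) ` A"
    using assms unfolding scaling_equivalent_def by blast
  then have "of_int ` B = (*) u ` (of_int ` A)" by (simp add: image_image)
  from ratios_scaled[OF u(1) this] show ?thesis by (simp add: ratios_of_int_image)
qed

lemma finite_ratios: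
  assumes "finite A"
  shows "finite (ratios A)"
proof -
  have "ratios A = (\<lambda>(x, y). of_int x / of_int y) ` (A \<times> A)" unfolding ratios_def by auto
  then show ?thesis using assms by simp
qed

definition doubly_D_quadruple :: "int set \<Rightarrow> bool" where
  "doubly_D_quadruple A \<longleftrightarrow>
     (\<exists>n1 n2. n1 \<noteq> 0 \<and> n2 \<noteq> 0 \<and> n1 \<noteq> n2 \<and> D_tuple n1 4 A \<and> D_tuple n2 4 A)"

lemma doubly_D_quadruple_large_ratio:
  fixes t :: rat
  shows "\<exists>A. doubly_D_quadruple A \<and> (\<exists>\<rho>\<in>ratios A. t \<le> \<rho>)"
proof -
  obtain X N where X: "finite X" "card X = 4" "0 \<notin> X" and N: "1 < N"
    and sq: "\<And>x y. x \<in> X \<Longrightarrow> y \<in> X \<Longrightarrow> x \<noteq> y \<Longrightarrow>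
      rat_square (x * y + 1) \<and> rat_square (x * y + N\<^sup>2)"
    and "\<exists>x\<in>X. \<exists>y\<in>X. max 10000 (20 * t) / 20 \<le> x / y"
    using rational_quadruple_large_ratio[of "max 10000 (20 * t)"] by (metis max.cobounded1)
  moreover have "t \<le> max 10000 (20 * t) / 20" by simp
  ultimately obtain x y where xy: "x \<in> X" "y \<in> X" "t \<le> x / y" using order_trans by blast
  \<comment> \<open>Including \<open>N\<close> makes \<open>D * N\<close> an integer
    \<open>M\<close>, so the parameters 1 and \<open>N^2\<close> scale to \<open>D^2\<close> and
    \<open>M^2\<close>; these differ because \<open>N > 1\<close>.\<close>
  obtain D :: int where D: "0 < D" "\<forall>x\<in>insert N X. of_int D * x \<in> \<int>"
    using common_denominator[of "insert N X"] X by auto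
  obtain M where M: "of_int M = of_int D * N" using D by (metis Ints_cases insertI1)
  define A where "A = {a. of_int a \<in> (*) (of_int D) ` X}"
  have A: "of_int ` A = (*) (of_int D) ` X"
    unfolding A_def using D by (auto elim!: Ints_cases) (metis Ints_cases image_eqI mem_Collect_eq)
  have "D < M"
  proof -
    have "of_int D < (of_int M :: rat)" using M N D(1) by simp
    then show ?thesis by simp
  qed
  have "D_tuple (D\<^sup>2) 4 A" using sq by (intro D_tuple_scaled[OF X D(1) A, of _ 1]) auto
  moreover have "D_tuple (M\<^sup>2) 4 A"
    using sq M by (intro D_tuple_scaled[OF X D(1) A, of _ "N\<^sup>2"]) (auto simp: power_mult_distrib)
  moreover have "D\<^sup>2 \<noteq> 0" "M\<^sup>2 \<noteq> 0" "D\<^sup>2 \<noteq> M\<^sup>2" using \<open>D < M\<close> D(1) by (auto simp: power2_eq_iff)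
  ultimately have "doubly_D_quadruple A" unfolding doubly_D_quadruple_def by blast
  moreover have "x / y \<in> ratios A" using D(1) xy by (subst ratios_scaled[OF _ A]) auto
  ultimately show ?thesis using xy by blast
qed

text \<open>Each quadruple has finitely many ratios, so finitely many ratio sets would have a
  finite, hence bounded, union, while arbitrarily large ratios occur.\<close>

lemma infinite_ratios_doubly_D_quadruple: "infinite (ratios ` Collect doubly_D_quadruple)"
proof
  assume fin: "finite (ratios ` Collect doubly_D_quadruple)"
  have "finite (ratios A)" if "doubly_D_quadruple A" for A
    using that by (auto simp: doubly_D_quadruple_def D_tuple_def intro: finite_ratios)
  then have "finite (\<Union> (ratios ` Collect doubly_D_quadruple))"
    using fin by (intro finite_Union) auto
  moreover have "bdd_above (\<Union> (ratios ` Collect doubly_D_quadruple))"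
    if "finite (\<Union> (ratios ` Collect doubly_D_quadruple))"
    using that by (rule bdd_above_finite)
  ultimately obtain t where t: "\<And>\<rho> A. doubly_D_quadruple A \<Longrightarrow> \<rho> \<in> ratios A \<Longrightarrow> \<rho> \<le> t"
    unfolding bdd_above_def by blast
  obtain A \<rho> where "doubly_D_quadruple A" "\<rho> \<in> ratios A" "t + 1 \<le> \<rho>"
    using doubly_D_quadruple_large_ratio by blast
  then show False using t[of A \<rho>] by simp
qed

theorem theorem1:
  "\<exists>S :: int set set.
     infinite S \<and>
     pairwise (\<lambda>A B. \<not> scaling_equivalent A B) S \<and>
     (\<forall>A\<in>S. \<exists>n1 n2 :: int. n1 \<noteq> 0 \<and> n2 \<noteq> 0 \<and> n1 \<noteq> n2 \<and> D_tuple n1 4 A \<and> D_tuple n2 4 A)"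
proof -
  \<comment> \<open>\<open>S\<close> contains exactly one quadruple for each ratio set that occurs,
    so distinct members have distinct invariants.\<close>
  obtain S where S: "S \<subseteq> Collect doubly_D_quadruple" "inj_on ratios S"
    "ratios ` S = ratios ` Collect doubly_D_quadruple"
    by (metis subset_image_inj order_refl)
  have "infinite S" using infinite_ratios_doubly_D_quadruple S(3) by (metis finite_imageI)
  moreover have "pairwise (\<lambda>A B. \<not> scaling_equivalent A B) S"
    unfolding pairwise_def using S(2) ratios_scaling_equivalent by (metis inj_onD)
  ultimately show ?thesis using S(1) unfolding doubly_D_quadruple_def by blast
qed

end
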